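(* Let $A\in\mathbb{R}^{N\times n}$, $b\in\mathbb{R}^N$ be such that $\mathcal{K}=\{f\in\mathbb{R}^n: Af\le b\}$ is a polytope in $X=\mathbb{R}^n$, let $\eta\ge 0$ and $\mathcal{E}=\{e\in\mathbb{R}^m:\|e\|_\infty\le\eta\}$. Let $L:\mathbb{R}^n\to\mathbb{R}^m$ be a linear map (identified with its $m\times n$ matrix), and let $Q:\mathbb{R}^n\to\ell_\infty^K$, $Q(f)=[Q_1(f);\ldots;Q_K(f)]$, be a linear map with $Q_k(f)=\langle q_k,f\rangle$, $q_k\in\mathbb{R}^n$, $k=1,\ldots,K$. For $y\in\mathbb{R}^m$ define $$\widetilde{A}=\begin{bmatrix}A\\ L\\ -L\end{bmatrix}\in\mathbb{R}^{(N+2m)\times n},\qquad \widetilde{b}=\begin{bmatrix} b\\ y+\eta\\ -y+\eta\end{bmatrix}\in\mathbb{R}^{N+2m},$$ where adding $\eta$ to a vector means adding it to every component. Then a map $R:\mathbb{R}^m\to\ell_\infty^K$ whose value $R(y)$ at each $y\in L(\mathcal{K})+\mathcal{E}$ is the component $z\in\mathbb{R}^K$ of a solution to the linear program $$\underset{\substack{z\in\mathbb{R}^K,\ r\in\mathbb{R}\\ x^{+,1},x^{-,1},\ldots,x^{+,K},x^{-,K}\in\mathbb{R}^{N+2m}}}{\text{minimize}}\ r\quad\text{subject to}\quad \widetilde{A}^\top x^{\pm,k}=\pm q_k,\quad x^{\pm,k}\ge 0,\quad \langle\widetilde{b},x^{\pm,k}\rangle\le r\pm z_k$$ (constraints for both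 signs and all $k=1,\ldots,K$) is locally optimal over $\mathcal{K}$ and $\mathcal{E}$ for the quantity of interest $Q$ at every $y\in L(\mathcal{K})+\mathcal{E}$.
   Context: Vector inequalities are componentwise, and in expressions with $\pm$ the same sign is taken throughout. $\ell_\infty^K$ is $\mathbb{R}^K$ with the max norm. For a model set $\mathcal{K}\subseteq X$, an uncertainty set $\mathcal{E}\subseteq\mathbb{R}^m$, a linear observation map $L:X\to\mathbb{R}^m$ and a linear map $Q:X\to Z$ into a normed space $Z$, a map $R:\mathbb{R}^m\to Z$ is called locally optimal over $\mathcal{K}$ and $\mathcal{E}$ at $y\in L(\mathcal{K})+\mathcal{E}$ if $$\sup_{\substack{f\in\mathcal{K},\,e\in\mathcal{E}\\ L(f)+e=y}}\|Q(f)-R(y)\|_Z=\inf_{w\in Z}\ \sup_{\substack{f\in\mathcal{K},\,e\in\mathcal{E}\\ L(f)+e=y}}\|Q(f)-w\|_Z .$$ *)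

theory Defs
  imports "HOL-Analysis.Analysis"
begin

text \<open>
  The norm of the target space is passed as the argument \<open>normZ\<close>, because the norm that
  the type class attaches to \<open>real ^ 'k\<close> is the Euclidean one, not the max norm of
  \<open>\<ell>\<^sub>\<infinity>\<close> (which is \<open>infnorm\<close>). Suprema and infima are taken in \<open>ereal\<close>, so that unbounded
  suprema have the value \<open>\<infinity>\<close>. The definition is meant for
  \<open>y\<close> in \<open>L ` \<K> + \<E>\<close>, where the suprema range over a nonempty set.
\<close>

definition locally_optimal_at ::
  "('z::real_vector \<Rightarrow> real) \<Rightarrow> 'x::real_vector set \<Rightarrow> (real ^ 'm) set \<Rightarrow>
   ('x \<Rightarrow> real ^ 'm) \<Rightarrow> ('x \<Rightarrow> 'z) \<Rightarrow> (real ^ 'm \<Rightarrow> 'z) \<Rightarrow> real ^ 'm \<Rightarrow> bool"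
  where
  "locally_optimal_at normZ \<K> \<E> L Q R y \<longleftrightarrow>
     (SUP (f, e) \<in> {(f, e). f \<in> \<K> \<and> e \<in> \<E> \<and> L f + e = y}. ereal (normZ (Q f - R y))) =
     (INF w. SUP (f, e) \<in> {(f, e). f \<in> \<K> \<and> e \<in> \<E> \<and> L f + e = y}. ereal (normZ (Q f - w)))"

definition stacked_matrix ::
  "real ^ 'n ^ 'N \<Rightarrow> real ^ 'n ^ 'm \<Rightarrow> real ^ 'n ^ ('N + 'm + 'm)"
  where
  "stacked_matrix A M = (\<chi> i. case i of
       Inl j \<Rightarrow> A $ j
     | Inr (Inl j) \<Rightarrow> M $ j
     | Inr (Inr j) \<Rightarrow> - (M $ j))"

definition stacked_vector ::
  "real ^ 'N \<Rightarrow> real \<Rightarrow> real ^ 'm \<Rightarrow> real ^ ('N + 'm + 'm)"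
  where
  "stacked_vector b \<eta> y = (\<chi> i. case i of
       Inl j \<Rightarrow> b $ j
     | Inr (Inl j) \<Rightarrow> y $ j + \<eta>
     | Inr (Inr j) \<Rightarrow> - (y $ j) + \<eta>)"

text \<open>Here \<open>\<le>\<close> on vectors is the componentwise order, and \<open>xp k\<close>, \<open>xm k\<close> are
  \<open>x\<close> with superscripts \<open>+,k\<close> and \<open>-,k\<close>.\<close>

definition lp_feasible ::
  "real ^ 'n ^ 'p \<Rightarrow> real ^ 'p \<Rightarrow> ('k \<Rightarrow> real ^ 'n) \<Rightarrow>
   (real ^ 'k) \<times> real \<times> ('k \<Rightarrow> real ^ 'p) \<times> ('k \<Rightarrow> real ^ 'p) \<Rightarrow> bool"
  where
  "lp_feasible At bt q = (\<lambda>(z, r, xp, xm). \<forall>k.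
       transpose At *v xp k = q k \<and> transpose At *v xm k = - q k \<and>
       0 \<le> xp k \<and> 0 \<le> xm k \<and>
       bt \<bullet> xp k \<le> r + z $ k \<and> bt \<bullet> xm k \<le> r - z $ k)"

definition lp_solution ::
  "real ^ 'n ^ 'p \<Rightarrow> real ^ 'p \<Rightarrow> ('k \<Rightarrow> real ^ 'n) \<Rightarrow>
   (real ^ 'k) \<times> real \<times> ('k \<Rightarrow> real ^ 'p) \<times> ('k \<Rightarrow> real ^ 'p) \<Rightarrow> bool"
  where
  "lp_solution At bt q s \<longleftrightarrow> is_arg_min (\<lambda>(z, r, xp, xm). r) (lp_feasible At bt q) s"

end

theory Submission imports Defs begin

text \<open>
  Let \<open>S\<close> be the (nonempty) set of all \<open>f\<close> compatible with \<open>y\<close>. It is the polyhedron of the stacked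
  system, so by the affine form of Farkas' lemma the inequality \<open>\<parallel>Q f - w\<parallel>\<^sub>\<infinity> \<le> \<rho>\<close> holds throughout
  \<open>S\<close> if and only if \<open>(w, \<rho>)\<close> extends to a feasible point of the linear program. Minimizing \<open>r\<close> in
  the program is therefore minimizing the worst-case error over \<open>w\<close>.
\<close>

lemma infnorm_cart_le_iff:
  fixes v :: "real ^ 'k"
  shows "infnorm v \<le> d \<longleftrightarrow> (\<forall>k. \<bar>v $ k\<bar> \<le> d)"
proof -
  have "infnorm v = Max (range (\<lambda>k. \<bar>v $ k\<bar>))"
    by (simp add: infnorm_cart cSup_eq_Max full_SetCompr_eq)
  then show ?thesis
    by simp
qed

lemma inner_transpose_mult:
  fixes M :: "real ^ 'n ^ 'p"
  shows "(transpose M *v x) \<bullet> f = x \<bullet> (M *v f)"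
  by (simp add: dot_lmul_matrix transpose_matrix_vector)

lemma inner_mono_vec:
  fixes x u v :: "real ^ 'p"
  assumes "0 \<le> x" "u \<le> v"
  shows "x \<bullet> u \<le> x \<bullet> v"
  using assms unfolding inner_vec_def less_eq_vec_def
  by (intro sum_mono) (simp add: mult_left_mono)

text \<open>Finitely generated cones are closed, so a pair \<open>(c, \<delta>)\<close> without the
  desired multipliers can be strictly separated from the cone of all consequences of the system. The
  separating functional then produces a feasible point that violates \<open>bound\<close>. The
  feasible point \<open>f0\<close> rules out the degenerate functional whose last component is
  zero.\<close>

lemma affine_farkas:
  fixes M :: "real ^ 'n ^ 'p" and d :: "real ^ 'p" and c :: "real ^ 'n"
  assumes f0: "M *v f0 \<le> d"
    and bound: "\<And>f. M *v f \<le> d \<Longrightarrow> c \<bullet> f \<le> \<delta>"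
  obtains x where "0 \<le> x" "transpose M *v x = c" "d \<bullet> x \<le> \<delta>"
proof -
  \<comment> \<open>The generator \<open>(0, 1)\<close> supplies the slack \<open>s\<close>:
    membership of \<open>(c, \<delta>)\<close> in \<open>T\<close> says
    \<open>\<delta> = d \<bullet> x + s\<close> with \<open>0 \<le> s\<close>, that is
    \<open>d \<bullet> x \<le> \<delta>\<close>. Closedness comes from the finiteness of
    \<open>G\<close>, multipliers from the explicit form of \<open>T\<close>; the inclusion of the
    hull in \<open>T\<close> links the two.\<close>
  define G where "G = insert (0, 1) (range (\<lambda>i. (M $ i, d $ i)))"
  define T where "T = {(transpose M *v x, d \<bullet> x + s) | x s. 0 \<le> x \<and> (0::real) \<le> s}"
  have "convex_cone T"
    unfolding convex_cone_iff
  proof (intro conjI ballI allI impI)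
    show "0 \<in> T"
      unfolding T_def
      by (intro CollectI exI[of _ "0::real ^ 'p"] exI[of _ "0::real"]) (simp add: zero_prod_def)
  next
    fix u v assume "u \<in> T" "v \<in> T"
    then obtain x s x' s' where "u = (transpose M *v x, d \<bullet> x + s)" "0 \<le> x" "0 \<le> s"
      "v = (transpose M *v x', d \<bullet> x' + s')" "0 \<le> x'" "0 \<le> s'"
      unfolding T_def by blast
    then show "u + v \<in> T"
      unfolding T_def
      by (intro CollectI exI[of _ "x + x'"] exI[of _ "s + s'"])
        (auto simp: matrix_vector_right_distrib inner_add_right less_eq_vec_def)
  next
    fix u and a :: real assume "u \<in> T" "0 \<le> a"
    then obtain x s where "u = (transpose M *v x, d \<bullet> x + s)" "0 \<le> x" "0 \<le> s"
      unfolding T_def by blast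
    with \<open>0 \<le> a\<close> show "a *\<^sub>R u \<in> T"
      unfolding T_def
      by (intro CollectI exI[of _ "a *\<^sub>R x"] exI[of _ "a * s"])
        (auto simp: matrix_vector_mult_scaleR less_eq_vec_def distrib_left)
  qed
  moreover have "G \<subseteq> T"
  proof -
    have "(0, 1) \<in> T"
      unfolding T_def
      by (intro CollectI exI[of _ "0::real ^ 'p"] exI[of _ "1::real"]) simp
    moreover have "(M $ i, d $ i) \<in> T" for i
    proof -
      have "0 \<le> (axis i 1 :: real ^ 'p)"
        by (simp add: less_eq_vec_def axis_def)
      moreover have "transpose M *v axis i 1 = M $ i"
        by (simp add: matrix_vector_mult_basis column_transpose row_def del: transpose_matrix_vector)
      ultimately show ?thesis
        unfolding T_def
        by (intro CollectI exI[of _ "axis i 1 :: real ^ 'p"] exI[of _ "0::real"])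
          (simp add: inner_axis del: transpose_matrix_vector)
    qed
    ultimately show ?thesis
      unfolding G_def by blast
  qed
  ultimately have hull: "convex_cone hull G \<subseteq> T"
    by (simp add: hull_minimal)
  have "(c, \<delta>) \<in> convex_cone hull G"
  proof (rule ccontr)
    assume "(c, \<delta>) \<notin> convex_cone hull G"
    moreover have "finite G"
      by (simp add: G_def)
    then have "closed (convex_cone hull G)"
      by (rule closed_convex_cone_hull)
    ultimately obtain n \<beta> where n: "n \<bullet> (c, \<delta>) < \<beta>" "\<And>g. g \<in> convex_cone hull G \<Longrightarrow> \<beta> < n \<bullet> g"
      using separating_hyperplane_closed_point[OF convex_convex_cone_hull] by blast
    obtain u t where ut: "n = (u, t)"
      by (cases n)
    have "\<beta> < 0"
      using n(2)[OF convex_cone_hull_contains_0] by simp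
    \<comment> \<open>If \<open>n\<close> were negative at a generator, the positive multiple of it
      on which \<open>n\<close> equals exactly \<open>\<beta>\<close> would still lie in the cone,
      against strict separation.\<close>
    have G_nonneg: "0 \<le> n \<bullet> g" if "g \<in> G" for g
    proof (rule ccontr)
      assume neg: "\<not> 0 \<le> n \<bullet> g"
      have "(\<beta> / (n \<bullet> g)) *\<^sub>R g \<in> convex_cone hull G"
        using that neg \<open>\<beta> < 0\<close>
        by (intro convex_cone_hull_mul hull_inc) (auto simp: divide_nonpos_nonpos)
      from n(2)[OF this] neg show False
        by simp
    qed
    have "0 \<le> t"
      using G_nonneg[of "(0, 1)"] by (simp add: G_def ut)
    have rows: "0 \<le> u \<bullet> M $ i + t * d $ i" for i
      using G_nonneg[of "(M $ i, d $ i)"] by (simp add: G_def ut)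
    have sep: "u \<bullet> c + t * \<delta> < 0"
      using n(1) \<open>\<beta> < 0\<close> by (simp add: ut)
    show False
    proof (cases "t = 0")
      case True
      have uc: "u \<bullet> c < 0"
        using sep True by simp
      \<comment> \<open>Here \<open>- u\<close> is a recession direction of the feasible set along
        which \<open>c\<close> strictly increases. The step length is large enough to bring
        \<open>c\<close> from its value at \<open>f0\<close> to at least
        \<open>\<delta> + 1\<close>; the maximum with 0 keeps it nonnegative when \<open>u\<close>
        is followed backwards.\<close>
      define s where "s = max 0 ((\<delta> - c \<bullet> f0 + 1) / - (u \<bullet> c))"
      have "0 \<le> s"
        by (simp add: s_def)
      have "M *v (f0 - s *\<^sub>R u) \<le> d"
        unfolding less_eq_vec_def
      proof
        fix i
        have "(M *v f0) $ i \<le> d $ i"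
          using f0 by (simp add: less_eq_vec_def)
        moreover have "0 \<le> s * (u \<bullet> M $ i)"
          using rows[of i] True \<open>0 \<le> s\<close> by simp
        ultimately show "(M *v (f0 - s *\<^sub>R u)) $ i \<le> d $ i"
          by (simp add: matrix_vector_mul_component inner_diff_right inner_commute)
      qed
      from bound[OF this] have "c \<bullet> f0 + s * - (u \<bullet> c) \<le> \<delta>"
        by (simp add: inner_diff_right inner_commute)
      moreover have "(\<delta> - c \<bullet> f0 + 1) / - (u \<bullet> c) \<le> s"
        by (simp add: s_def)
      then have "\<delta> - c \<bullet> f0 + 1 \<le> s * - (u \<bullet> c)"
        using uc by (subst (asm) pos_divide_le_eq) auto
      ultimately show False
        by simp
    next
      case False
      with \<open>0 \<le> t\<close> have "0 < t"
        by simp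
      \<comment> \<open>Dividing by \<open>t\<close> turns \<open>rows\<close> into feasibility of
        \<open>- u / t\<close>, and \<open>sep\<close> into the statement that \<open>c\<close>
        exceeds \<open>\<delta>\<close> there.\<close>
      have "M *v (- (1 / t) *\<^sub>R u) \<le> d"
        unfolding less_eq_vec_def
      proof
        fix i
        show "(M *v (- (1 / t) *\<^sub>R u)) $ i \<le> d $ i"
          using rows[of i] \<open>0 < t\<close>
          by (simp add: matrix_vector_mul_component inner_commute field_simps)
      qed
      from bound[OF this] sep \<open>0 < t\<close> show False
        by (simp add: inner_commute field_simps)
    qed
  qed
  with hull that show thesis
    unfolding T_def by fastforce
qed

text \<open>The two lower blocks are the two halves of the absolute values in the max norm. The
  residual \<open>y - M *v f\<close> is the only observation error compatible with \<open>f\<close>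
  and \<open>y\<close>, so the error variable is eliminated.\<close>

lemma stacked_le_iff:
  fixes A :: "real ^ 'n ^ 'N" and M :: "real ^ 'n ^ 'm"
  shows "stacked_matrix A M *v f \<le> stacked_vector b \<eta> y \<longleftrightarrow>
    A *v f \<le> b \<and> infnorm (y - M *v f) \<le> \<eta>"
proof -
  have "stacked_matrix A M *v f \<le> stacked_vector b \<eta> y \<longleftrightarrow>
    (\<forall>j. (A *v f) $ j \<le> b $ j) \<and> (\<forall>j. (M *v f) $ j \<le> y $ j + \<eta>) \<and>
    (\<forall>j. - (M *v f) $ j \<le> - (y $ j) + \<eta>)"
    unfolding less_eq_vec_def stacked_matrix_def stacked_vector_def
    by (simp add: matrix_vector_mul_component split_sum_all)
  also have "\<dots> \<longleftrightarrow> A *v f \<le> b \<and> (\<forall>j. \<bar>(y - M *v f) $ j\<bar> \<le> \<eta>)"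
    unfolding less_eq_vec_def abs_le_iff by (force simp: algebra_simps)
  finally show ?thesis
    by (simp add: infnorm_cart_le_iff)
qed

text \<open>Weak duality: pairing \<open>M *v f \<le> d\<close> with the nonnegative vectors
  \<open>xp k\<close> and \<open>xm k\<close> gives the upper and the lower bound on the k-th
  component.\<close>

lemma lp_feasible_bounds:
  fixes Q :: "real ^ 'n \<Rightarrow> real ^ 'k"
  assumes Q: "\<And>f k. Q f $ k = q k \<bullet> f"
    and feas: "lp_feasible M d q (z, r, xp, xm)"
    and f: "M *v f \<le> d"
  shows "infnorm (Q f - z) \<le> r"
  unfolding infnorm_cart_le_iff
proof
  fix k
  have *: "transpose M *v xp k = q k" "transpose M *v xm k = - q k" "0 \<le> xp k" "0 \<le> xm k"
    "d \<bullet> xp k \<le> r + z $ k" "d \<bullet> xm k \<le> r - z $ k"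
    using feas by (auto simp: lp_feasible_def)
  have "q k \<bullet> f \<le> r + z $ k"
    using inner_transpose_mult[of M "xp k" f] inner_mono_vec[OF *(3) f] *
    by (simp add: inner_commute)
  moreover have "- (q k \<bullet> f) \<le> r - z $ k"
    using inner_transpose_mult[of M "xm k" f] inner_mono_vec[OF *(4) f] *
    by (simp add: inner_commute)
  ultimately show "\<bar>(Q f - z) $ k\<bar> \<le> r"
    by (simp add: Q)
qed

text \<open>The converse, by strong duality: the norm bound splits into one affine inequality per
  index and sign, and each receives its own multipliers from \<open>affine_farkas\<close>.\<close>

lemma lp_feasible_of_bounds:
  fixes Q :: "real ^ 'n \<Rightarrow> real ^ 'k"
  assumes Q: "\<And>f k. Q f $ k = q k \<bullet> f"
    and f0: "M *v f0 \<le> d"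
    and bound: "\<And>f. M *v f \<le> d \<Longrightarrow> infnorm (Q f - w) \<le> \<rho>"
  obtains xp xm where "lp_feasible M d q (w, \<rho>, xp, xm)"
proof -
  have *: "\<bar>q k \<bullet> f - w $ k\<bar> \<le> \<rho>" if "M *v f \<le> d" for k f
    using bound[OF that] by (simp add: infnorm_cart_le_iff Q)
  have "\<exists>x. 0 \<le> x \<and> transpose M *v x = q k \<and> d \<bullet> x \<le> \<rho> + w $ k" for k
    using affine_farkas[OF f0, of "q k" "\<rho> + w $ k"] *[of _ k] by (smt (verit))
  moreover have "\<exists>x. 0 \<le> x \<and> transpose M *v x = - q k \<and> d \<bullet> x \<le> \<rho> - w $ k" for k
    using affine_farkas[OF f0, of "- q k" "\<rho> - w $ k"] *[of _ k] by (smt (verit) inner_minus_left)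
  ultimately obtain xp xm where
    "\<And>k. 0 \<le> xp k \<and> transpose M *v xp k = q k \<and> d \<bullet> xp k \<le> \<rho> + w $ k"
    "\<And>k. 0 \<le> xm k \<and> transpose M *v xm k = - q k \<and> d \<bullet> xm k \<le> \<rho> - w $ k"
    by metis
  then show thesis
    by (intro that[of xp xm]) (simp add: lp_feasible_def)
qed

theorem theorem1:
  fixes A :: "real ^ 'n ^ 'N" and b :: "real ^ 'N"
    and \<eta> :: real
    and L :: "real ^ 'n \<Rightarrow> real ^ 'm"
    and Q :: "real ^ 'n \<Rightarrow> real ^ 'K" and q :: "'K \<Rightarrow> real ^ 'n"
    and R :: "real ^ 'm \<Rightarrow> real ^ 'K"
    and \<K> :: "(real ^ 'n) set" and \<E> :: "(real ^ 'm) set"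
  assumes K_def: "\<K> = {f. A *v f \<le> b}"
    and K_polytope: "polytope \<K>"
    and eta_nonneg: "0 \<le> \<eta>"
    and E_def: "\<E> = {e. infnorm e \<le> \<eta>}"
    and L_linear: "linear L"
    and Q_linear: "linear Q"
    and Q_comp: "\<And>f k. Q f $ k = q k \<bullet> f"
    and R_lp: "\<And>y. y \<in> L ` \<K> + \<E> \<Longrightarrow>
      \<exists>r xp xm. lp_solution (stacked_matrix A (matrix L)) (stacked_vector b \<eta> y) q (R y, r, xp, xm)"
  shows "\<forall>y \<in> L ` \<K> + \<E>. locally_optimal_at infnorm \<K> \<E> L Q R y"
proof
  fix y assume y: "y \<in> L ` \<K> + \<E>"
  define M where "M = stacked_matrix A (matrix L)"
  define d where "d = stacked_vector b \<eta> y"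
  define S where "S = {(f, e). f \<in> \<K> \<and> e \<in> \<E> \<and> L f + e = y}"
  have compat: "M *v f \<le> d \<longleftrightarrow> (f, y - L f) \<in> S" for f
    by (simp add: M_def d_def S_def stacked_le_iff K_def E_def matrix_vector_mul(2)[OF L_linear])
  have S_eq: "f \<in> fst ` S \<longleftrightarrow> M *v f \<le> d" for f
    unfolding compat by (force simp: S_def)
  from y obtain f0 where f0: "M *v f0 \<le> d"
    unfolding compat by (force simp: S_def set_plus_def)
  define err where "err w = (SUP (f, e) \<in> S. ereal (infnorm (Q f - w)))" for w
  have err_le: "err w \<le> ereal \<rho> \<longleftrightarrow> (\<forall>f. M *v f \<le> d \<longrightarrow> infnorm (Q f - w) \<le> \<rho>)" for w \<rho>
    unfolding err_def SUP_le_iff S_eq[symmetric] by force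
  obtain r xp xm where "lp_solution M d q (R y, r, xp, xm)"
    using R_lp[OF y] unfolding M_def d_def by blast
  then have feas: "lp_feasible M d q (R y, r, xp, xm)"
    and r_min: "\<And>z \<rho> xp xm. lp_feasible M d q (z, \<rho>, xp, xm) \<Longrightarrow> r \<le> \<rho>"
    by (force simp: lp_solution_def is_arg_min_linorder)+
  have upper: "err (R y) \<le> ereal r"
    using lp_feasible_bounds[OF Q_comp feas] by (simp add: err_le)
  \<comment> \<open>A finite worst-case error is itself the objective value of a feasible point, an
    infinite one is trivial, and the value of an empty supremum is excluded by
    \<open>f0\<close>.\<close>
  have "ereal r \<le> err w" for w
  proof (cases "err w")
    case (real \<rho>)
    then have "\<And>f. M *v f \<le> d \<Longrightarrow> infnorm (Q f - w) \<le> \<rho>"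
      using err_le[of w \<rho>] by simp
    from lp_feasible_of_bounds[OF Q_comp f0 this] real r_min show ?thesis
      by (metis ereal_less_eq(3))
  next
    case MInf
    have "ereal (infnorm (Q f0 - w)) \<le> err w"
      unfolding err_def using f0 by (intro SUP_upper2[of "(f0, y - L f0)"]) (auto simp: compat)
    with MInf show ?thesis
      by simp
  qed simp
  with upper have "err (R y) \<le> err w" for w
    by (rule order_trans)
  then have "err (R y) = (INF w. err w)"
    by (intro antisym INF_greatest INF_lower) auto
  then show "locally_optimal_at infnorm \<K> \<E> L Q R y"
    unfolding locally_optimal_at_def err_def S_def .
qed

end
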